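(* Let $\mathcal M$ and $\mathcal N=\{N^{(\lambda)}:\lambda\in\mathbb R_{>0}\}$ be two quasianalytic weight matrices such that $\sup_{k\in\mathbb N_{>0}}(n^{(\lambda)}_k)^{1/k}=+\infty$ for all $\lambda>0$ (Roumieu case) resp. $\lim_{k\to+\infty}(n^{(\lambda)}_k)^{1/k}=+\infty$ for all $\lambda>0$ (Beurling case). Then $j^\infty(\mathcal E^{0,r}_{\{\mathcal M\}})\cap\Lambda^r_{[\mathcal N]}\subsetneq\Lambda^r_{[\mathcal N]}$ (and hence also $j^\infty(\mathcal E^{0,r}_{(\mathcal M)})\cap\Lambda^r_{[\mathcal N]}\subsetneq\Lambda^r_{[\mathcal N]}$). In particular the Borel map $j^\infty:\mathcal E^{0,r}_{[\mathcal N]}\to\Lambda^r_{[\mathcal N]}$ is not surjective.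
   Context: For a sequence $M=(M_p)_{p\in\mathbb N}$ of positive reals write $m_p:=M_p/p!$. $M$ is a weight sequence if $1=M_0\le M_1$, $M_p^2\le M_{p-1}M_{p+1}$ for all $p\ge1$, and $\liminf_{p\to\infty}m_p^{1/p}>0$; it is quasianalytic if $\sum_{p\ge1}M_{p-1}/M_p=+\infty$. A weight matrix is a family $\mathcal M=\{M^{(\lambda)}:\lambda\in\mathbb R_{>0}\}$ of weight sequences with $M^{(\lambda)}_p\le M^{(\kappa)}_p$ for all $p$ whenever $\lambda\le\kappa$; write $n^{(\lambda)}_p:=N^{(\lambda)}_p/p!$. It is quasianalytic if every member is quasianalytic. For $U\subseteq\mathbb R^r$ open, $K\subseteq U$ compact, $h>0$: $\|f\|^M_{K,h}:=\sup_{\alpha\in\mathbb N^r,x\in K}|\partial^\alpha f(x)|/(h^{|\alpha|}M_{|\alpha|})$. $\mathcal E_{\{\mathcal M\}}(U)$: smooth $f$ such that for every compact $K\subseteq U$ there exist $\lambda>0$, $h>0$ with $\|f\|^{M^{(\lambda)}}_{K,h}<\infty$; $\mathcal E_{(\mathcal M)}(U)$: smooth $f$ with $\|f\|^{M^{(\lambda)}}_{K,h}<\infty$ for all compact $K$, all $\lambda>0$, all $h>0$. $\mathcal E^{0,r}_{\{\mathcal M\}}$, $\mathcal E^{0,r}_{(\mathcal M)}$ are the corresponding spaces of germs at $0\in\mathbb R^r$ (functions in the class on some cube $(-1/k,1/k)^r$). For $\mathbf b=(b_\alpha)_{\alpha\in\mathbb N^r}$, a weight sequence $N$, $h>0$: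 $|\mathbf b|^N_h:=\sup_\alpha|b_\alpha|/(h^{|\alpha|}n_{|\alpha|})$; $\Lambda^r_{\{\mathcal N\}}:=\{\mathbf b:\exists\lambda>0\,\exists h>0,\ |\mathbf b|^{N^{(\lambda)}}_h<\infty\}$, $\Lambda^r_{(\mathcal N)}:=\{\mathbf b:\forall\lambda>0\,\forall h>0,\ |\mathbf b|^{N^{(\lambda)}}_h<\infty\}$. The Borel map is $j^\infty(f)=(\partial^\alpha f(0)/|\alpha|!)_{\alpha\in\mathbb N^r}$. $[\cdot]$ means $\{\cdot\}$ throughout or $(\cdot)$ throughout. *)

theory Defs
  imports "HOL-Analysis.Analysis"
begin

definition weight_seq :: "(nat \<Rightarrow> real) \<Rightarrow> bool" where
  "weight_seq M \<longleftrightarrow> (\<forall>p. M p > 0) \<and> M 0 = 1 \<and> M 0 \<le> M 1 \<and>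
     (\<forall>p\<ge>1. (M p)\<^sup>2 \<le> M (p - 1) * M (p + 1)) \<and>
     Liminf sequentially (\<lambda>p. ereal (root p (M p / fact p))) > 0"

(* sum_{p>=1} M_{p-1}/M_p = +infinity; the terms are positive *)
definition quasianalytic_seq :: "(nat \<Rightarrow> real) \<Rightarrow> bool" where
  "quasianalytic_seq M \<longleftrightarrow> \<not> summable (\<lambda>p. M p / M (Suc p))"

(* a weight matrix is indexed by lambda in R_{>0}; values at lambda <= 0 are irrelevant *)
definition weight_matrix :: "(real \<Rightarrow> nat \<Rightarrow> real) \<Rightarrow> bool" where
  "weight_matrix \<M> \<longleftrightarrow> (\<forall>l>0. weight_seq (\<M> l)) \<and>
     (\<forall>l kap. 0 < l \<longrightarrow> l \<le> kap \<longrightarrow> (\<forall>p. \<M> l p \<le> \<M> kap p))"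

definition quasianalytic_matrix :: "(real \<Rightarrow> nat \<Rightarrow> real) \<Rightarrow> bool" where
  "quasianalytic_matrix \<M> \<longleftrightarrow> (\<forall>l>0. quasianalytic_seq (\<M> l))"

definition partial :: "'n::finite \<Rightarrow> (real^'n \<Rightarrow> real) \<Rightarrow> real^'n \<Rightarrow> real" where
  "partial i g x = deriv (\<lambda>t. g (x + t *\<^sub>R axis i 1)) 0"

fun iter_partial :: "'n::finite list \<Rightarrow> (real^'n \<Rightarrow> real) \<Rightarrow> real^'n \<Rightarrow> real" where
  "iter_partial [] f = f"
| "iter_partial (i # is) f = partial i (iter_partial is f)"

definition smooth_on :: "(real^'n::finite) set \<Rightarrow> (real^'n \<Rightarrow> real) \<Rightarrow> bool" where
  "smooth_on U f \<longleftrightarrow> (\<forall>is. continuous_on U (iter_partial is f) \<and>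
     (\<forall>i. \<forall>x\<in>U. (\<lambda>t. iter_partial is f (x + t *\<^sub>R axis i 1)) differentiable (at 0)))"

definition mlen :: "('n::finite \<Rightarrow> nat) \<Rightarrow> nat" where
  "mlen \<alpha> = (\<Sum>i\<in>UNIV. \<alpha> i)"

(* \<partial>^\<alpha> f: differentiate alpha i times in direction i (order irrelevant for smooth f) *)
definition pderiv_multi :: "('n::finite \<Rightarrow> nat) \<Rightarrow> (real^'n \<Rightarrow> real) \<Rightarrow> real^'n \<Rightarrow> real" where
  "pderiv_multi \<alpha> f = iter_partial (SOME is. \<forall>i. count_list is i = \<alpha> i) f"

definition seminorm_finite :: "(nat \<Rightarrow> real) \<Rightarrow> (real^'n::finite) set \<Rightarrow> real \<Rightarrow> (real^'n \<Rightarrow> real) \<Rightarrow> bool" where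
  "seminorm_finite M K h f \<longleftrightarrow>
     (\<exists>C. \<forall>\<alpha>. \<forall>x\<in>K. \<bar>pderiv_multi \<alpha> f x\<bar> / (h ^ mlen \<alpha> * M (mlen \<alpha>)) \<le> C)"

definition E_Roumieu :: "(real \<Rightarrow> nat \<Rightarrow> real) \<Rightarrow> (real^'n::finite) set \<Rightarrow> (real^'n \<Rightarrow> real) set" where
  "E_Roumieu \<M> U = {f. smooth_on U f \<and> (\<forall>K. compact K \<and> K \<subseteq> U \<longrightarrow>
      (\<exists>l>0. \<exists>h>0. seminorm_finite (\<M> l) K h f))}"

definition E_Beurling :: "(real \<Rightarrow> nat \<Rightarrow> real) \<Rightarrow> (real^'n::finite) set \<Rightarrow> (real^'n \<Rightarrow> real) set" where
  "E_Beurling \<M> U = {f. smooth_on U f \<and> (\<forall>K. compact K \<and> K \<subseteq> U \<longrightarrow>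
      (\<forall>l>0. \<forall>h>0. seminorm_finite (\<M> l) K h f))}"

definition cube :: "nat \<Rightarrow> (real^'n::finite) set" where
  "cube k = {x. \<forall>i. \<bar>x $ i\<bar> < 1 / real k}"

definition jet :: "(real^'n::finite \<Rightarrow> real) \<Rightarrow> ('n \<Rightarrow> nat) \<Rightarrow> real" where
  "jet f = (\<lambda>\<alpha>. pderiv_multi \<alpha> f 0 / fact (mlen \<alpha>))"

(* j^\<infinity>(E^{0,r}_{[M]}): images of germs at 0, i.e. of functions in the class on some cube *)
definition jets_Roumieu :: "(real \<Rightarrow> nat \<Rightarrow> real) \<Rightarrow> (('n::finite \<Rightarrow> nat) \<Rightarrow> real) set" where
  "jets_Roumieu \<M> = {jet f | f k. k \<ge> 1 \<and> f \<in> E_Roumieu \<M> (cube k)}"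

definition jets_Beurling :: "(real \<Rightarrow> nat \<Rightarrow> real) \<Rightarrow> (('n::finite \<Rightarrow> nat) \<Rightarrow> real) set" where
  "jets_Beurling \<M> = {jet f | f k. k \<ge> 1 \<and> f \<in> E_Beurling \<M> (cube k)}"

definition seqnorm_finite :: "(nat \<Rightarrow> real) \<Rightarrow> real \<Rightarrow> (('n::finite \<Rightarrow> nat) \<Rightarrow> real) \<Rightarrow> bool" where
  "seqnorm_finite N h b \<longleftrightarrow>
     (\<exists>C. \<forall>\<alpha>. \<bar>b \<alpha>\<bar> / (h ^ mlen \<alpha> * (N (mlen \<alpha>) / fact (mlen \<alpha>))) \<le> C)"

definition Lambda_Roumieu :: "(real \<Rightarrow> nat \<Rightarrow> real) \<Rightarrow> (('n::finite \<Rightarrow> nat) \<Rightarrow> real) set" where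
  "Lambda_Roumieu \<N> = {b. \<exists>l>0. \<exists>h>0. seqnorm_finite (\<N> l) h b}"

definition Lambda_Beurling :: "(real \<Rightarrow> nat \<Rightarrow> real) \<Rightarrow> (('n::finite \<Rightarrow> nat) \<Rightarrow> real) set" where
  "Lambda_Beurling \<N> = {b. \<forall>l>0. \<forall>h>0. seqnorm_finite (\<N> l) h b}"

end

theory Submission
  imports Defs
begin

text \<open>
  If all derivatives of a quasianalytic function g at 0 are positive, they stay positive to the
  right of 0. Otherwise some derivative, say g itself, has a zero, and Rolle's argument together
  with the positivity at 0 yields a decreasing sequence of points at which the successive
  derivatives vanish; a theorem of Bang then forces g to vanish. By Taylor's formula the Taylor
  coefficients of g at 0 are therefore bounded by a geometric sequence. So any jet in the given
  sequence space that is positive along a coordinate axis and grows faster than geometrically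
  there is not the jet of a quasianalytic germ, whatever the quasianalytic matrix.
\<close>

section \<open>Bang's estimate for zeros of successive derivatives\<close>

lemma log_convex_ratio_mono:
  fixes M :: "nat \<Rightarrow> real"
  assumes pos: "\<And>p. 0 < M p"
    and lc: "\<And>p. (M (Suc p))\<^sup>2 \<le> M p * M (Suc (Suc p))"
    and "j \<le> k"
  shows "M (Suc j) / M j \<le> M (Suc k) / M k"
proof -
  have "M (Suc p) / M p \<le> M (Suc (Suc p)) / M (Suc p)" for p
    using lc[of p] pos[of p] pos[of "Suc p"]
    by (simp add: field_simps power2_eq_square)
  then have "incseq (\<lambda>p. M (Suc p) / M p)"
    by (intro incseq_SucI)
  then show ?thesis
    using \<open>j \<le> k\<close> by (rule incseqD)
qed

text \<open>Both \<open>\<phi> - f\<close> and \<open>\<phi> + f\<close> are nondecreasing on the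
  interval. This replaces integrating a bound on the derivative in Bang's argument.\<close>

lemma abs_le_of_derivative_dominated:
  fixes f \<phi> :: "real \<Rightarrow> real"
  assumes "a \<le> b" and fa: "\<bar>f a\<bar> \<le> \<phi> a"
    and f: "\<And>t. a \<le> t \<Longrightarrow> t \<le> b \<Longrightarrow> (f has_real_derivative f' t) (at t)"
    and \<phi>: "\<And>t. a \<le> t \<Longrightarrow> t \<le> b \<Longrightarrow> (\<phi> has_real_derivative \<phi>' t) (at t)"
    and le: "\<And>t. a \<le> t \<Longrightarrow> t \<le> b \<Longrightarrow> \<bar>f' t\<bar> \<le> \<phi>' t"
  shows "\<bar>f b\<bar> \<le> \<phi> b"
proof -
  have "\<phi> a - f a \<le> \<phi> b - f b"
  proof (rule DERIV_nonneg_imp_nondecreasing[OF \<open>a \<le> b\<close>])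
    fix t assume t: "a \<le> t" "t \<le> b"
    show "\<exists>y. ((\<lambda>t. \<phi> t - f t) has_real_derivative y) (at t) \<and> 0 \<le> y"
      using DERIV_diff[OF \<phi>[OF t] f[OF t]] le[OF t] by (intro exI[of _ "\<phi>' t - f' t"]) auto
  qed
  moreover have "\<phi> a + f a \<le> \<phi> b + f b"
  proof (rule DERIV_nonneg_imp_nondecreasing[OF \<open>a \<le> b\<close>])
    fix t assume t: "a \<le> t" "t \<le> b"
    show "\<exists>y. ((\<lambda>t. \<phi> t + f t) has_real_derivative y) (at t) \<and> 0 \<le> y"
      using DERIV_add[OF \<phi>[OF t] f[OF t]] le[OF t] by (intro exI[of _ "\<phi>' t + f' t"]) auto
  qed
  ultimately show ?thesis
    using fa by linarith
qed

text \<open>Descending induction on \<open>j\<close> from \<open>Suc k\<close>, where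
  \<open>bnd\<close> suffices. Below that, log-convexity bounds \<open>M (Suc j) / M j\<close> by
  \<open>M (Suc k) / M k\<close>, so the bound for \<open>g (Suc j)\<close> is at most the
  derivative of the bound for \<open>g j\<close>. This dictates the rate in the last exponential;
  its factor \<open>exp 1\<close> comes from the index shift in the first one.\<close>

lemma Bang_exponential_bound:
  fixes g :: "nat \<Rightarrow> real \<Rightarrow> real" and M :: "nat \<Rightarrow> real"
  assumes der: "\<And>n t. 0 \<le> t \<Longrightarrow> t \<le> b \<Longrightarrow> (g n has_real_derivative g (Suc n) t) (at t)"
    and bnd: "\<And>n t. 0 \<le> t \<Longrightarrow> t \<le> b \<Longrightarrow> \<bar>g n t\<bar> \<le> M n"
    and pos: "\<And>p. 0 < M p"
    and lc: "\<And>p. (M (Suc p))\<^sup>2 \<le> M p * M (Suc (Suc p))"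
    and x: "decseq x" "\<And>n. 0 \<le> x n" "\<And>n. g n (x n) = 0"
    and start: "\<And>j. j \<le> k \<Longrightarrow> x j \<le> Y \<Longrightarrow> Y \<le> b \<Longrightarrow> \<bar>g j Y\<bar> \<le> M j * exp (real j - real (Suc k))"
    and "j \<le> Suc k" "x j \<le> y" "Y \<le> y" "y \<le> b"
  shows "\<bar>g j y\<bar> \<le> M j * exp (real j - real (Suc k)) * exp (exp 1 * (M (Suc k) / M k) * (y - Y))"
proof -
  define c where "c = exp 1 * (M (Suc k) / M k)"
  define R where "R j s = M j * exp (real j - real (Suc k)) * exp (c * (s - Y))" for j s
  have c0: "0 \<le> c"
    unfolding c_def using pos by (simp add: less_imp_le)
  have "\<forall>y. x j \<le> y \<longrightarrow> Y \<le> y \<longrightarrow> y \<le> b \<longrightarrow> \<bar>g j y\<bar> \<le> R j y"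
    using \<open>j \<le> Suc k\<close>
  proof (induction rule: inc_induct)
    case base
    show ?case
    proof (intro allI impI)
      fix y assume y: "x (Suc k) \<le> y" "Y \<le> y" "y \<le> b"
      then have "\<bar>g (Suc k) y\<bar> \<le> M (Suc k)"
        using x(2)[of "Suc k"] by (intro bnd) auto
      also have "\<dots> \<le> R (Suc k) y"
        unfolding R_def using c0 y pos[of "Suc k"] by simp
      finally show "\<bar>g (Suc k) y\<bar> \<le> R (Suc k) y" .
    qed
  next
    case (step j)
    have jk: "j \<le> k" using step by simp
    show ?case
    proof (intro allI impI)
      fix y assume y: "x j \<le> y" "Y \<le> y" "y \<le> b"
      \<comment> \<open>The comparison starts either at \<open>Y\<close>, where \<open>start\<close>
        gives the initial bound, or at the zero \<open>x j\<close>, where the initial value is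
        0.\<close>
      define a where "a = max (x j) Y"
      have a0: "0 \<le> a" using x(2)[of j] by (simp add: a_def)
      show "\<bar>g j y\<bar> \<le> R j y"
      proof (rule abs_le_of_derivative_dominated[where f = "g j" and \<phi> = "R j" and a = a and b = y
            and f' = "g (Suc j)" and \<phi>' = "\<lambda>t. R j t * c"])
        show "a \<le> y" using y by (simp add: a_def)
        show "\<bar>g j a\<bar> \<le> R j a"
        proof (cases "x j \<le> Y")
          case True
          then have "a = Y" by (simp add: a_def)
          then show ?thesis using start[OF jk True] y by (simp add: R_def)
        next
          case False
          then have "a = x j" by (simp add: a_def)
          then show ?thesis using x(3)[of j] pos[of j] by (simp add: R_def)
        qed
      next
        fix t assume t: "a \<le> t" "t \<le> y"
        show "(g j has_real_derivative g (Suc j) t) (at t)"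
          using t a0 y by (intro der) auto
        show "(R j has_real_derivative R j t * c) (at t)"
          unfolding R_def by (auto intro!: derivative_eq_intros)
        have "x (Suc j) \<le> x j" using x(1) by (simp add: decseq_SucD)
        then have "\<bar>g (Suc j) t\<bar> \<le> R (Suc j) t"
          using step.IH t y by (auto simp: a_def)
        also have "\<dots> = M (Suc j) * exp 1 * (exp (real j - real (Suc k)) * exp (c * (t - Y)))"
          by (simp add: R_def exp_add[symmetric] algebra_simps)
        also have "\<dots> \<le> (M j * (M (Suc k) / M k)) * exp 1 * (exp (real j - real (Suc k)) * exp (c * (t - Y)))"
          using log_convex_ratio_mono[where M = M, OF pos lc jk] pos[of j]
          by (intro mult_right_mono) (auto simp: field_simps)
        also have "\<dots> = R j t * c"
          by (simp add: R_def c_def)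
        finally show "\<bar>g (Suc j) t\<bar> \<le> R j t * c" .
      qed
    qed
  qed
  then show ?thesis
    using \<open>x j \<le> y\<close> \<open>Y \<le> y\<close> \<open>y \<le> b\<close> unfolding R_def c_def by blast
qed

text \<open>Descending induction on \<open>n\<close> from \<open>N\<close>. A step from
  \<open>Suc k\<close> to \<open>k\<close> gives up one factor \<open>exp 1\<close> in the bound and
  gains the length \<open>M k / M (Suc k) / exp 1\<close> in the range of \<open>y\<close>, over
  which the exponential of \<open>Bang_exponential_bound\<close> grows by at most
  \<open>exp 1\<close>.\<close>

lemma Bang_zeros_bound:
  fixes g :: "nat \<Rightarrow> real \<Rightarrow> real" and M :: "nat \<Rightarrow> real"
  assumes der: "\<And>n t. 0 \<le> t \<Longrightarrow> t \<le> b \<Longrightarrow> (g n has_real_derivative g (Suc n) t) (at t)"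
    and bnd: "\<And>n t. 0 \<le> t \<Longrightarrow> t \<le> b \<Longrightarrow> \<bar>g n t\<bar> \<le> M n"
    and pos: "\<And>p. 0 < M p"
    and lc: "\<And>p. (M (Suc p))\<^sup>2 \<le> M p * M (Suc (Suc p))"
    and x: "decseq x" "\<And>n. 0 \<le> x n" "\<And>n. g n (x n) = 0"
    and "n \<le> N"
  shows "\<forall>j\<le>n. \<forall>y. x j \<le> y \<longrightarrow> y \<le> b \<longrightarrow> y \<le> x N + (\<Sum>i=n..<N. M i / M (Suc i)) / exp 1 \<longrightarrow>
           \<bar>g j y\<bar> \<le> M j * exp (real j - real n)"
  using \<open>n \<le> N\<close>
proof (induction rule: inc_induct)
  case base
  show ?case
  proof (intro allI impI)
    \<comment> \<open>The sum is empty, so the range of \<open>y\<close> collapses to the zero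
      \<open>x j\<close>.\<close>
    fix j y assume jy: "j \<le> N" "x j \<le> y" "y \<le> x N + (\<Sum>i=N..<N. M i / M (Suc i)) / exp 1"
    have "x N \<le> x j" using x(1) jy(1) by (rule decseqD)
    then have "y = x j" using jy by simp
    then show "\<bar>g j y\<bar> \<le> M j * exp (real j - real N)"
      using x(3)[of j] pos[of j] by simp
  qed
next
  case (step k)
  define Y where "Y = x N + (\<Sum>i=Suc k..<N. M i / M (Suc i)) / exp 1"
  have Y: "x N + (\<Sum>i=k..<N. M i / M (Suc i)) / exp 1 = Y + M k / M (Suc k) / exp 1"
    unfolding Y_def using step.hyps by (simp add: sum.atLeast_Suc_lessThan add_divide_distrib)
  note IH = step.IH[folded Y_def]
  show ?case
    unfolding Y
  proof (intro allI impI)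
    fix j y assume jy: "j \<le> k" "x j \<le> y" "y \<le> b" "y \<le> Y + M k / M (Suc k) / exp 1"
    show "\<bar>g j y\<bar> \<le> M j * exp (real j - real k)"
    proof (cases "y \<le> Y")
      case True
      then have "\<bar>g j y\<bar> \<le> M j * exp (real j - real (Suc k))"
        using IH jy by auto
      also have "\<dots> \<le> M j * exp (real j - real k)"
        using pos[of j] by simp
      finally show ?thesis .
    next
      case False
      have "\<bar>g j y\<bar> \<le> M j * exp (real j - real (Suc k)) * exp (exp 1 * (M (Suc k) / M k) * (y - Y))"
        using False jy IH
        by (intro Bang_exponential_bound[where g = g and b = b and x = x and M = M and k = k and Y = Y] der bnd pos lc x) auto
      also have "\<dots> \<le> M j * exp (real j - real (Suc k)) * exp 1"
      proof -
        have "exp 1 * (M (Suc k) / M k) * (y - Y) \<le> exp 1 * (M (Suc k) / M k) * (M k / M (Suc k) / exp 1)"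
          using jy pos by (intro mult_left_mono) (auto simp: less_imp_le)
        also have "\<dots> = 1"
          using pos[of k] pos[of "Suc k"] by simp
        finally show ?thesis
          using pos[of j] by simp
      qed
      also have "\<dots> = M j * exp (real j - real k)"
        by (simp add: exp_add[symmetric])
      finally show ?thesis .
    qed
  qed
qed

text \<open>
  Only points to the right of the zeros are treated: the j-th derivative needs to be
  controlled to the right of the j-th zero only, and since the zeros decrease this region is
  contained in the one for the next derivative. Points on the left are reached afterwards by the
  Denjoy-Carleman theorem, from a point where the function is flat.
\<close>

theorem Bang_zeros:
  fixes g :: "nat \<Rightarrow> real \<Rightarrow> real" and M :: "nat \<Rightarrow> real"
  assumes der: "\<And>n t. 0 \<le> t \<Longrightarrow> t \<le> b \<Longrightarrow> (g n has_real_derivative g (Suc n) t) (at t)"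
    and bnd: "\<And>n t. 0 \<le> t \<Longrightarrow> t \<le> b \<Longrightarrow> \<bar>g n t\<bar> \<le> M n"
    and pos: "\<And>p. 0 < M p"
    and lc: "\<And>p. (M (Suc p))\<^sup>2 \<le> M p * M (Suc (Suc p))"
    and qa: "\<not> summable (\<lambda>p. M p / M (Suc p))"
    and x: "decseq x" "\<And>n. 0 \<le> x n" "\<And>n. g n (x n) = 0"
    and y: "x 0 \<le> y" "y \<le> b"
  shows "g 0 y = 0"
proof -
  have bound: "\<bar>g 0 y\<bar> \<le> M 0 * exp (- real m)" for m
  proof -
    define r where "r i = M (i + m) / M (Suc (i + m))" for i
    have "\<not> summable r"
      using qa unfolding r_def using summable_iff_shift[of "\<lambda>p. M p / M (Suc p)" m] by simp
    moreover have "0 \<le> r i" for i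
      unfolding r_def using pos by (simp add: less_imp_le)
    \<comment> \<open>Divergence of the tail starting at \<open>m\<close> makes the range of
      \<open>Bang_zeros_bound\<close> cover everything up to \<open>b\<close>, however large
      \<open>m\<close> is.\<close>
    ultimately obtain K where K: "exp 1 * b < (\<Sum>i<K. r i)"
      using summableI_nonneg_bounded[of r "exp 1 * b"] by (meson not_le)
    have "(\<Sum>i=m..<m + K. M i / M (Suc i)) = (\<Sum>i<K. r i)"
      unfolding r_def
      using sum.shift_bounds_nat_ivl[of "\<lambda>i. M i / M (Suc i)" 0 m K]
      by (simp add: add.commute lessThan_atLeast0)
    then have "b \<le> (\<Sum>i=m..<m + K. M i / M (Suc i)) / exp 1"
      using K by (simp add: field_simps)
    then have "y \<le> x (m + K) + (\<Sum>i=m..<m + K. M i / M (Suc i)) / exp 1"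
      using y x(2)[of "m + K"] by linarith
    then show ?thesis
      using Bang_zeros_bound[where b = b and n = m and N = "m + K", OF der bnd pos lc x le_add1,
        rule_format, of 0 y] y by simp
  qed
  have "(\<lambda>m. M 0 * exp (- real m)) \<longlonglongrightarrow> 0"
    using LIMSEQ_realpow_zero[of "exp (-1::real)"]
    by (intro tendsto_mult_right_zero) (simp add: exp_of_nat_mult[symmetric])
  then have "\<bar>g 0 y\<bar> \<le> 0"
    using bound by (intro LIMSEQ_le_const) auto
  then show ?thesis by simp
qed

section \<open>Quasianalytic functions of one variable with positive jets\<close>

text \<open>The reflection of \<open>t\<close> to \<open>b - t\<close> moves the flat point to 0, so
  Bang's theorem applies with all zeros equal to 0. The sign \<open>(-1) ^ n\<close> keeps the
  reflected family a chain of derivatives.\<close>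

corollary Denjoy_Carleman:
  fixes g :: "nat \<Rightarrow> real \<Rightarrow> real" and M :: "nat \<Rightarrow> real"
  assumes der: "\<And>n t. 0 \<le> t \<Longrightarrow> t \<le> b \<Longrightarrow> (g n has_real_derivative g (Suc n) t) (at t)"
    and bnd: "\<And>n t. 0 \<le> t \<Longrightarrow> t \<le> b \<Longrightarrow> \<bar>g n t\<bar> \<le> M n"
    and pos: "\<And>p. 0 < M p"
    and lc: "\<And>p. (M (Suc p))\<^sup>2 \<le> M p * M (Suc (Suc p))"
    and qa: "\<not> summable (\<lambda>p. M p / M (Suc p))"
    and flat: "\<And>n. g n b = 0" and "0 \<le> b"
  shows "g 0 0 = 0"
proof -
  define h where "h n t = (-1) ^ n * g n (b - t)" for n t
  have "h 0 b = 0"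
  proof (rule Bang_zeros[where g = h and b = b and M = M and x = "\<lambda>_. 0" and y = b])
    fix n t assume t: "0 \<le> t" "t \<le> b"
    have "((\<lambda>t. g n (b - t)) has_real_derivative g (Suc n) (b - t) * (-1)) (at t)"
      using t by (intro DERIV_chain2[OF der]) (auto intro!: derivative_eq_intros)
    from DERIV_cmult[OF this, of "(-1) ^ n"]
    show "(h n has_real_derivative h (Suc n) t) (at t)"
      unfolding h_def by simp
    show "\<bar>h n t\<bar> \<le> M n"
      using bnd[of "b - t" n] t by (simp add: h_def abs_mult power_abs)
  qed (use pos lc qa flat \<open>0 \<le> b\<close> in \<open>auto simp: h_def decseq_def\<close>)
  then show ?thesis by (simp add: h_def)
qed

text \<open>Bang's theorem only annihilates \<open>g 0\<close> to the right of the first zero. All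
  derivatives then vanish at a point there, and \<open>Denjoy_Carleman\<close> carries this back to
  0, contradicting the positive jet.\<close>

lemma quasianalytic_positive:
  fixes g :: "nat \<Rightarrow> real \<Rightarrow> real" and M :: "nat \<Rightarrow> real"
  assumes der: "\<And>n t. 0 \<le> t \<Longrightarrow> t \<le> b \<Longrightarrow> (g n has_real_derivative g (Suc n) t) (at t)"
    and bnd: "\<And>n t. 0 \<le> t \<Longrightarrow> t \<le> b \<Longrightarrow> \<bar>g n t\<bar> \<le> M n"
    and pos: "\<And>p. 0 < M p"
    and lc: "\<And>p. (M (Suc p))\<^sup>2 \<le> M p * M (Suc (Suc p))"
    and qa: "\<not> summable (\<lambda>p. M p / M (Suc p))"
    and jet: "\<And>n. 0 < g n 0"
    and t: "0 \<le> t" "t < b"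
  shows "0 < g 0 t"
proof (rule ccontr)
  assume "\<not> 0 < g 0 t"
  have zero: "\<exists>z>0. z \<le> s \<and> g n z = 0" if "0 \<le> s" "s < b" "g n s \<le> 0" for n s
  proof -
    have "\<exists>z\<ge>0. z \<le> s \<and> g n z = 0"
      using that jet[of n] DERIV_isCont[OF der] by (intro IVT2) auto
    then show ?thesis
      using jet[of n] by (metis less_eq_real_def less_irrefl)
  qed
  have "\<exists>x. \<forall>n. (0 < x n \<and> x n < b \<and> g n (x n) = 0) \<and> x (Suc n) \<le> x n"
  proof (rule dependent_nat_choice)
    obtain z where "0 < z" "z \<le> t" "g 0 z = 0"
      using zero[OF t, of 0] \<open>\<not> 0 < g 0 t\<close> by auto
    then show "\<exists>x. 0 < x \<and> x < b \<and> g 0 x = 0"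
      using t by (intro exI[of _ z]) auto
  next
    fix s n assume s: "0 < s \<and> s < b \<and> g n s = 0"
    \<comment> \<open>Falling from a positive value at 0 to 0 at \<open>s\<close> forces a negative
      slope at some \<open>z\<close>. As \<open>g (Suc n)\<close> is positive at 0, it has a zero in
      between.\<close>
    obtain z where z: "0 < z" "z < s" "g n s - g n 0 = (s - 0) * g (Suc n) z"
      using MVT2[of 0 s "g n" "g (Suc n)"] s der by auto
    then have "s * g (Suc n) z < 0"
      using s jet[of n] by simp
    then have "g (Suc n) z \<le> 0"
      using s by (simp add: mult_less_0_iff)
    then obtain w where "w > 0" "w \<le> z" "g (Suc n) w = 0"
      using zero[of z "Suc n"] z s by auto
    then show "\<exists>y. (0 < y \<and> y < b \<and> g (Suc n) y = 0) \<and> y \<le> s"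
      using z s by (intro exI[of _ w]) auto
  qed
  then obtain x where x: "\<And>n. 0 < x n" "\<And>n. x n < b" "\<And>n. g n (x n) = 0" "\<And>n. x (Suc n) \<le> x n"
    by blast
  have vanish: "\<forall>y. x 0 < y \<and> y < b \<longrightarrow> g n y = 0" for n
  proof (induction n)
    case 0
    then show ?case
      using x Bang_zeros[where g = g and b = b and x = x, OF der bnd pos lc qa]
      by (auto simp: decseq_Suc_iff less_imp_le)
  next
    case (Suc n)
    show ?case
    proof (intro allI impI)
      fix y assume y: "x 0 < y \<and> y < b"
      have "(g n has_real_derivative 0) (at y)"
        by (rule has_field_derivative_transform_within_open[of "\<lambda>_. 0" 0 y "{x 0<..<b}"])
          (use y Suc in auto)
      moreover have "(g n has_real_derivative g (Suc n) y) (at y)"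
        using y x(1)[of 0] by (intro der) auto
      ultimately show "g (Suc n) y = 0"
        by (rule DERIV_unique[symmetric])
    qed
  qed
  \<comment> \<open>An interior point is chosen because \<open>vanish\<close> covers only the open
    interval.\<close>
  define c where "c = (x 0 + b) / 2"
  have "x 0 < c" "c < b"
    unfolding c_def using x(2)[of 0] by (auto simp: field_simps)
  then have "g 0 0 = 0"
    using x(1)[of 0] vanish
    by (intro Denjoy_Carleman[where g = g and b = c and M = M] der bnd pos lc qa) auto
  then show False
    using jet[of 0] by simp
qed

text \<open>All terms of Taylor's formula at \<open>s\<close>, including the Lagrange remainder, are
  nonnegative, so each single term is at most \<open>g 0 s\<close>, as for absolutely monotone
  functions.\<close>

lemma quasianalytic_positive_jet_bound:
  fixes g :: "nat \<Rightarrow> real \<Rightarrow> real" and M :: "nat \<Rightarrow> real"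
  assumes der: "\<And>n t. 0 \<le> t \<Longrightarrow> t \<le> b \<Longrightarrow> (g n has_real_derivative g (Suc n) t) (at t)"
    and bnd: "\<And>n t. 0 \<le> t \<Longrightarrow> t \<le> b \<Longrightarrow> \<bar>g n t\<bar> \<le> M n"
    and pos: "\<And>p. 0 < M p"
    and lc: "\<And>p. (M (Suc p))\<^sup>2 \<le> M p * M (Suc (Suc p))"
    and qa: "\<not> summable (\<lambda>p. M p / M (Suc p))"
    and jet: "\<And>n. 0 < g n 0"
    and s: "0 < s" "s < b"
  shows "g n 0 / fact n \<le> g 0 s * (1 / s) ^ n"
proof -
  have positive: "0 < g m t" if "0 \<le> t" "t < b" for m t
  \<comment> \<open>The hypotheses survive dropping the first \<open>m\<close> members of both
    sequences, so positivity passes to every derivative.\<close>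
  proof (rule quasianalytic_positive[where g = "\<lambda>n. g (n + m)" and M = "\<lambda>n. M (n + m)" and b = b and t = t, simplified])
    show "\<not> summable (\<lambda>p. M (p + m) / M (Suc (p + m)))"
      using qa summable_iff_shift[of "\<lambda>p. M p / M (Suc p)" m] by simp
  qed (use der bnd pos lc jet that in auto)
  obtain t where t: "0 < t" "t < s"
    "g 0 s = (\<Sum>m<Suc n. g m 0 / fact m * s ^ m) + g (Suc n) t / fact (Suc n) * s ^ Suc n"
    using Maclaurin[of s "Suc n" g "g 0"] s der by force
  have "g n 0 / fact n * s ^ n \<le> (\<Sum>m<Suc n. g m 0 / fact m * s ^ m)"
    using jet s by (simp add: sum_nonneg less_imp_le)
  moreover have "0 \<le> g (Suc n) t / fact (Suc n) * s ^ Suc n"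
    using positive[of t "Suc n"] t s by (simp add: less_imp_le)
  ultimately have "g n 0 / fact n * s ^ n \<le> g 0 s"
    using t(3) by linarith
  then show ?thesis
    using s by (simp add: field_simps)
qed

section \<open>Restricting germs in several variables to a coordinate axis\<close>

abbreviation axis_index :: "'n \<Rightarrow> nat \<Rightarrow> 'n \<Rightarrow> nat" where
  "axis_index i n \<equiv> (\<lambda>j. if j = i then n else 0)"

lemma mlen_axis_index: "mlen (axis_index i n) = n"
  by (simp add: mlen_def)

text \<open>The choice in \<open>pderiv_multi\<close> is determined here, since the constant list is
  the only one with these counts. The value is thus an iterated derivative along one axis.\<close>

lemma pderiv_multi_axis_index:
  "pderiv_multi (axis_index i n) f = iter_partial (replicate n i) f"
proof -
  have unique: "is = replicate n i" if "\<forall>j. count_list is j = axis_index i n j" for "is"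
  proof -
    have "\<forall>j\<in>set is. j = i"
      using that by (metis count_list_0_iff)
    then have "is = replicate (length is) i"
      by (metis replicate_eqI)
    moreover have "count_list (replicate m i) i = m" for m
      by (induction m) auto
    ultimately show ?thesis
      using that by metis
  qed
  have "(SOME is. \<forall>j. count_list is j = axis_index i n j) = replicate n i"
  proof (rule some_equality)
    show "\<forall>j. count_list (replicate n i) j = axis_index i n j"
      by (induction n) auto
  qed (rule unique)
  then show ?thesis
    by (simp add: pderiv_multi_def)
qed

text \<open>The restriction of the germ to the axis \<open>i\<close> is a quasianalytic function of
  one variable with positive jet, so \<open>quasianalytic_positive_jet_bound\<close> applies to
  it.\<close>

lemma jets_Roumieu_positive_bound:
  fixes b :: "('n::finite \<Rightarrow> nat) \<Rightarrow> real"
  assumes "weight_matrix \<M>" "quasianalytic_matrix \<M>" "b \<in> jets_Roumieu \<M>"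
    and positive: "\<And>n. 0 < b (axis_index i n)"
  shows "\<exists>C D. 0 < D \<and> (\<forall>n. b (axis_index i n) \<le> C * D ^ n)"
proof -
  obtain f k where k: "k \<ge> 1" and f: "f \<in> E_Roumieu \<M> (cube k)" and b: "b = jet f"
    using assms(3) unfolding jets_Roumieu_def by blast
  define e where "e = (axis i 1 :: real^'n)"
  define g where "g n t = iter_partial (replicate n i) f (t *\<^sub>R e)" for n t
  \<comment> \<open>Half the side bound of the cube, so that the closed segment lies in the open
    cube and a single pair \<open>l\<close>, \<open>h\<close> serves all of it.\<close>
  define a where "a = 1 / (2 * real k)"
  have a0: "0 < a" using k by (simp add: a_def)
  have cube: "t *\<^sub>R e \<in> cube k" if "0 \<le> t" "t \<le> a" for t
    using that k by (auto simp: cube_def e_def axis_def a_def field_simps)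
  have smooth: "smooth_on (cube k) f"
    using f by (simp add: E_Roumieu_def)
  have der: "(g n has_real_derivative g (Suc n) t) (at t)" if t: "0 \<le> t" "t \<le> a" for n t
  proof -
    have "(\<lambda>s. iter_partial (replicate n i) f (t *\<^sub>R e + s *\<^sub>R e)) differentiable (at 0)"
      using smooth cube[OF t] unfolding smooth_on_def e_def by blast
    then have "(\<lambda>s. g n (s + t)) differentiable (at 0)"
      by (simp add: g_def scaleR_add_left add.commute)
    then have "((\<lambda>s. g n (s + t)) has_real_derivative deriv (\<lambda>s. g n (s + t)) 0) (at 0)"
      by (simp add: DERIV_deriv_iff_real_differentiable)
    moreover have "deriv (\<lambda>s. g n (s + t)) 0 = g (Suc n) t"
      by (simp add: g_def partial_def e_def scaleR_add_left add.commute)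
    ultimately show ?thesis
      using DERIV_shift[of "g n" "g (Suc n) t" 0 t] by simp
  qed
  have "compact ((\<lambda>t. t *\<^sub>R e) ` {0..a})"
    by (intro compact_continuous_image continuous_intros) auto
  moreover have "(\<lambda>t. t *\<^sub>R e) ` {0..a} \<subseteq> cube k"
    using cube by auto
  ultimately obtain l h where lh: "0 < l" "0 < h"
    and fin: "seminorm_finite (\<M> l) ((\<lambda>t. t *\<^sub>R e) ` {0..a}) h f"
    using f unfolding E_Roumieu_def by blast
  have ws: "weight_seq (\<M> l)" and qa: "quasianalytic_seq (\<M> l)"
    using assms lh by (auto simp: weight_matrix_def quasianalytic_matrix_def)
  have posM: "0 < \<M> l p" for p
    using ws by (simp add: weight_seq_def)
  have lcM: "(\<M> l (Suc p))\<^sup>2 \<le> \<M> l p * \<M> l (Suc (Suc p))" for p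
    using ws by (auto simp: weight_seq_def dest!: spec[of _ "Suc p"])
  obtain C where C: "\<And>\<alpha> x. x \<in> (\<lambda>t. t *\<^sub>R e) ` {0..a} \<Longrightarrow>
      \<bar>pderiv_multi \<alpha> f x\<bar> / (h ^ mlen \<alpha> * \<M> l (mlen \<alpha>)) \<le> C"
    using fin unfolding seminorm_finite_def by blast
  \<comment> \<open>Constant and geometric factors preserve log-convexity and only scale the ratios
    by \<open>1 / h\<close>; \<open>max C 1\<close> makes the sequence positive even if
    \<open>C\<close> is 0.\<close>
  define M where "M n = max C 1 * h ^ n * \<M> l n" for n
  have bnd: "\<bar>g n t\<bar> \<le> M n" if t: "0 \<le> t" "t \<le> a" for n t
  proof -
    have "\<bar>g n t\<bar> / (h ^ n * \<M> l n) \<le> C"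
      using C[of "t *\<^sub>R e" "axis_index i n", OF imageI] t
      by (simp add: mlen_axis_index pderiv_multi_axis_index g_def)
    also have "C \<le> max C 1" by simp
    finally show ?thesis
      using lh posM[of n] by (simp add: M_def field_simps)
  qed
  have posn: "0 < M n" for n
    using lh posM[of n] by (simp add: M_def)
  have lc: "(M (Suc p))\<^sup>2 \<le> M p * M (Suc (Suc p))" for p
  proof -
    have "(max C 1 * h ^ Suc p)\<^sup>2 * (\<M> l (Suc p))\<^sup>2 \<le> (max C 1 * h ^ Suc p)\<^sup>2 * (\<M> l p * \<M> l (Suc (Suc p)))"
      using lcM by (intro mult_left_mono) auto
    then show ?thesis
      by (simp add: M_def power2_eq_square mult_ac)
  qed
  have ratio: "M p / M (Suc p) = (1 / h) * (\<M> l p / \<M> l (Suc p))" for p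
    using lh by (simp add: M_def)
  have nqa: "\<not> summable (\<lambda>p. M p / M (Suc p))"
    unfolding ratio summable_cmult_iff using qa lh by (simp add: quasianalytic_seq_def)
  have jet: "b (axis_index i n) = g n 0 / fact n" for n
    by (simp add: b jet_def mlen_axis_index pderiv_multi_axis_index g_def)
  have "0 < g n 0" for n
    using positive[of n] by (simp add: jet zero_less_divide_iff)
  then have "b (axis_index i n) \<le> g 0 (a / 2) * (1 / (a / 2)) ^ n" for n
    unfolding jet using a0
    by (intro quasianalytic_positive_jet_bound[where g = g and M = M and b = a] der bnd posn lc nqa) auto
  then show ?thesis
    using a0 by (intro exI[of _ "g 0 (a / 2)"] exI[of _ "1 / (a / 2)"]) auto
qed

lemma jets_Beurling_subset_Roumieu: "jets_Beurling \<M> \<subseteq> jets_Roumieu \<M>"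
proof -
  have "E_Beurling \<M> U \<subseteq> E_Roumieu \<M> U" for U
    unfolding E_Beurling_def E_Roumieu_def using zero_less_one by blast
  then show ?thesis
    unfolding jets_Beurling_def jets_Roumieu_def by blast
qed

section \<open>Sequences of faster than geometric growth\<close>

text \<open>For positive \<open>\<beta>\<close> this says that the power series with coefficients
  \<open>\<beta> n\<close> has a positive radius of convergence.\<close>

definition geometrically_bounded :: "(nat \<Rightarrow> real) \<Rightarrow> bool" where
  "geometrically_bounded \<beta> \<longleftrightarrow> (\<exists>C D. 0 < D \<and> (\<forall>n. \<beta> n \<le> C * D ^ n))"

lemma geometrically_bounded_root:
  assumes "geometrically_bounded \<beta>" and pos: "\<And>k. 0 < \<beta> k"
  shows "\<exists>B. \<forall>k>0. root k (\<beta> k) \<le> B"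
proof -
  obtain C D where D: "0 < D" and C: "\<And>n. \<beta> n \<le> C * D ^ n"
    using assms(1) by (auto simp: geometrically_bounded_def)
  have "root k (\<beta> k) \<le> max C 1 * D" if k: "0 < k" for k
  proof -
    \<comment> \<open>For \<open>k > 0\<close> the constant is absorbed into the base of the
      power.\<close>
    have "C \<le> max C 1 ^ k"
      using self_le_power[of "max C 1" k] k by simp
    then have "C * D ^ k \<le> max C 1 ^ k * D ^ k"
      using D by (intro mult_right_mono) auto
    then have "\<beta> k \<le> (max C 1 * D) ^ k"
      using C[of k] by (simp add: power_mult_distrib)
    then have "root k (\<beta> k) \<le> root k ((max C 1 * D) ^ k)"
      using k by simp
    also have "\<dots> = max C 1 * D"
      using k D by (intro real_root_power_cancel) auto
    finally show ?thesis .
  qed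
  then show ?thesis by blast
qed

text \<open>A sequence depending only on the length of the multi-index takes the values
  \<open>\<beta> n\<close> along every axis. The condition on \<open>\<beta>\<close> does not
  involve the matrix, so one witness serves for all quasianalytic matrices.\<close>

lemma not_jets_Roumieu:
  assumes "weight_matrix \<M>" "quasianalytic_matrix \<M>"
    and pos: "\<And>k. 0 < \<beta> k" and "\<not> geometrically_bounded \<beta>"
  shows "(\<lambda>\<alpha>::'n::finite \<Rightarrow> nat. \<beta> (mlen \<alpha>)) \<notin> jets_Roumieu \<M>"
proof
  assume "(\<lambda>\<alpha>::'n \<Rightarrow> nat. \<beta> (mlen \<alpha>)) \<in> jets_Roumieu \<M>"
  from jets_Roumieu_positive_bound[OF assms(1,2) this] pos assms(4) show False
    by (simp add: mlen_axis_index geometrically_bounded_def)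
qed

text \<open>One \<open>\<beta>\<close> has to lie below all weights for all \<open>h\<close> at
  once. It is built as a k-th power with a base tending to infinity, and its square still lies below
  the weight; the spare factor absorbs \<open>h ^ k\<close>.\<close>

lemma exists_Beurling_witness:
  fixes n :: "real \<Rightarrow> nat \<Rightarrow> real"
  assumes pos: "\<And>l k. 0 < l \<Longrightarrow> 0 < n l k"
    and mono: "\<And>l l' k. 0 < l \<Longrightarrow> l \<le> l' \<Longrightarrow> n l k \<le> n l' k"
    and lim: "\<And>l. 0 < l \<Longrightarrow> filterlim (\<lambda>k. root k (n l k)) at_top sequentially"
  obtains \<beta> where "\<And>k. 0 < \<beta> k" "\<And>l h. 0 < l \<Longrightarrow> 0 < h \<Longrightarrow> \<exists>C. \<forall>k. \<beta> k / (h ^ k * n l k) \<le> C"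
    "\<not> geometrically_bounded \<beta>"
proof -
  \<comment> \<open>Diagonalise: \<open>J k\<close> tends to infinity so slowly that
    \<open>(J k + 1)\<^sup>2\<close> stays below the k-th root of the weight with parameter \<open>1 / (J k + 1)\<close>.\<close>
  define Q where "Q j k \<longleftrightarrow> real (Suc j) ^ (2 * k) \<le> n (1 / real (Suc j)) k" for j k
  \<comment> \<open>The inserted 0 is a default that keeps the set nonempty, and
    \<open>j \<le> k\<close> keeps it finite.\<close>
  define J where "J k = Max (insert 0 {j. j \<le> k \<and> Q j k})" for k
  define \<beta> where "\<beta> k = real (Suc (J k)) ^ k" for k
  have J_in: "J k \<in> insert 0 {j. j \<le> k \<and> Q j k}" for k
    unfolding J_def by (intro Max_in) auto
  have evQ: "\<forall>\<^sub>F k in sequentially. Q j k" for j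
  proof -
    have "\<forall>\<^sub>F k in sequentially. (real (Suc j))\<^sup>2 \<le> root k (n (1 / real (Suc j)) k)"
      using lim[of "1 / real (Suc j)"] by (simp add: filterlim_at_top)
    then show ?thesis
      using eventually_gt_at_top[of 0]
    proof eventually_elim
      case (elim k)
      have "((real (Suc j))\<^sup>2) ^ k \<le> root k (n (1 / real (Suc j)) k) ^ k"
        using elim by (intro power_mono) auto
      also have "\<dots> = n (1 / real (Suc j)) k"
        using elim pos[of "1 / real (Suc j)" k] by (intro real_root_pow_pos2) auto
      finally show ?case by (simp add: Q_def power_mult)
    qed
  qed
  have evJ: "\<forall>\<^sub>F k in sequentially. j \<le> J k" for j
    using evQ[of j] eventually_ge_at_top[of j]
  proof eventually_elim
    case (elim k)
    then show ?case unfolding J_def by (intro Max_ge) auto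
  qed
  show ?thesis
  proof (rule that)
    show pos\<beta>: "0 < \<beta> k" for k
      by (simp add: \<beta>_def)
    show "\<exists>C. \<forall>k. \<beta> k / (h ^ k * n l k) \<le> C" if l: "0 < l" and h: "0 < h" for l h
    proof -
      obtain j where j: "max (1 / l) (1 / h) < real j"
        using reals_Archimedean2 by blast
      have "\<forall>\<^sub>F k in sequentially. \<beta> k / (h ^ k * n l k) \<le> 1"
        using evJ[of "Suc j"]
      proof eventually_elim
        case (elim k)
        define S where "S = real (Suc (J k))"
        have S: "1 / l \<le> S" "1 / h \<le> S" "0 < S"
          using elim j by (auto simp: S_def)
        have "1 / S \<le> l"
          using S(1,3) l by (simp add: field_simps)
        \<comment> \<open>Here \<open>J k\<close> is positive, hence not the default 0, for which
          \<open>Q\<close> might fail.\<close>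
        moreover have "Q (J k) k"
          using J_in[of k] elim by auto
        ultimately have "S ^ k * S ^ k \<le> n l k"
          using mono[of "1 / S" l k] S unfolding Q_def S_def[symmetric]
          by (simp add: mult_2 power_add)
        moreover have "1 \<le> (h * S) ^ k"
          using S(2) h by (intro one_le_power) (simp add: field_simps)
        ultimately have "1 * (S ^ k * S ^ k) \<le> (h * S) ^ k * n l k"
          using S by (intro mult_mono) auto
        then have "S ^ k * S ^ k \<le> S ^ k * (h ^ k * n l k)"
          by (simp only: power_mult_distrib mult_1 mult_ac)
        then have "S ^ k \<le> h ^ k * n l k"
          using S(3) by simp
        then show ?case
          using h pos[OF l, of k] by (simp add: \<beta>_def S_def)
      qed
      then obtain K where K: "\<And>k. K \<le> k \<Longrightarrow> \<beta> k / (h ^ k * n l k) \<le> 1"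
        by (auto simp: eventually_sequentially)
      define C where "C = Max (insert 1 ((\<lambda>k. \<beta> k / (h ^ k * n l k)) ` {..<K}))"
      have "\<beta> k / (h ^ k * n l k) \<le> C" for k
      proof (cases "k < K")
        case True
        then show ?thesis unfolding C_def by (intro Max_ge) auto
      next
        case False
        then have "\<beta> k / (h ^ k * n l k) \<le> 1" by (intro K) simp
        also have "1 \<le> C" unfolding C_def by (intro Max_ge) auto
        finally show ?thesis .
      qed
      then show ?thesis by blast
    qed
    show "\<not> geometrically_bounded \<beta>"
    proof
      assume "geometrically_bounded \<beta>"
      then obtain B where B: "\<And>k. 0 < k \<Longrightarrow> root k (\<beta> k) \<le> B"
        using geometrically_bounded_root pos\<beta> by blast
      obtain j where j: "B < real j"
        using reals_Archimedean2 by blast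
      have "\<forall>\<^sub>F k in sequentially. False"
        using evJ[of j] eventually_gt_at_top[of 0]
      proof eventually_elim
        case (elim k)
        then have "root k (\<beta> k) = real (Suc (J k))"
          unfolding \<beta>_def by (intro real_root_power_cancel) auto
        then show False
          using B[of k] elim j by simp
      qed
      then show False by simp
    qed
  qed
qed

section \<open>Witnesses in the Roumieu and Beurling cases\<close>

theorem mainTheorem10:
  fixes \<M> \<N> :: "real \<Rightarrow> nat \<Rightarrow> real"
  assumes "weight_matrix \<M>" and "quasianalytic_matrix \<M>"
    and "weight_matrix \<N>" and "quasianalytic_matrix \<N>"
  shows
    "((\<forall>l>0. (SUP k\<in>{0<..}. ereal (root k (\<N> l k / fact k))) = \<infinity>) \<longrightarrow>
        jets_Roumieu \<M> \<inter> Lambda_Roumieu \<N> \<subset> (Lambda_Roumieu \<N> :: (('n::finite \<Rightarrow> nat) \<Rightarrow> real) set) \<and>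
        jets_Beurling \<M> \<inter> Lambda_Roumieu \<N> \<subset> (Lambda_Roumieu \<N> :: (('n \<Rightarrow> nat) \<Rightarrow> real) set) \<and>
        \<not> (Lambda_Roumieu \<N> :: (('n \<Rightarrow> nat) \<Rightarrow> real) set) \<subseteq> jets_Roumieu \<N>)
   \<and> ((\<forall>l>0. filterlim (\<lambda>k. root k (\<N> l k / fact k)) at_top sequentially) \<longrightarrow>
        jets_Roumieu \<M> \<inter> Lambda_Beurling \<N> \<subset> (Lambda_Beurling \<N> :: (('n \<Rightarrow> nat) \<Rightarrow> real) set) \<and>
        jets_Beurling \<M> \<inter> Lambda_Beurling \<N> \<subset> (Lambda_Beurling \<N> :: (('n \<Rightarrow> nat) \<Rightarrow> real) set) \<and>
        \<not> (Lambda_Beurling \<N> :: (('n \<Rightarrow> nat) \<Rightarrow> real) set) \<subseteq> jets_Beurling \<N>)"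
proof (intro conjI impI)
  have posN: "0 < \<N> l k" if "0 < l" for l k
    using assms(3) that by (simp add: weight_matrix_def weight_seq_def)
  have monoN: "\<N> l k \<le> \<N> l' k" if "0 < l" "l \<le> l'" for l l' k
    using assms(3) that by (simp add: weight_matrix_def)
  {
    assume sup: "\<forall>l>0. (SUP k\<in>{0<..}. ereal (root k (\<N> l k / fact k))) = \<infinity>"
    \<comment> \<open>The weight itself is the witness: its norm for \<open>l = 1\<close> and
      \<open>h = 1\<close> is 1, and unbounded roots exclude geometric growth.\<close>
    define \<beta> where "\<beta> k = \<N> 1 k / fact k" for k
    define b where "b = (\<lambda>\<alpha>::'n \<Rightarrow> nat. \<beta> (mlen \<alpha>))"
    have pos: "0 < \<beta> k" for k
      using posN by (simp add: \<beta>_def)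
    have "\<not> geometrically_bounded \<beta>"
    proof
      assume "geometrically_bounded \<beta>"
      then obtain B where "\<And>k. 0 < k \<Longrightarrow> root k (\<beta> k) \<le> B"
        using geometrically_bounded_root pos by blast
      then have "(SUP k\<in>{0<..}. ereal (root k (\<beta> k))) \<le> ereal B"
        by (intro SUP_least) auto
      then show False
        using sup by (simp add: \<beta>_def)
    qed
    then have notin: "b \<notin> jets_Roumieu \<M>" "b \<notin> jets_Roumieu \<N>"
      using not_jets_Roumieu[OF assms(1,2) pos] not_jets_Roumieu[OF assms(3,4) pos]
      by (simp_all add: b_def)
    have "seqnorm_finite (\<N> 1) 1 b"
      unfolding seqnorm_finite_def b_def \<beta>_def using posN
      by (intro exI[of _ 1]) (simp add: less_imp_neq[symmetric] less_imp_le)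
    then have mem: "b \<in> Lambda_Roumieu \<N>"
      unfolding Lambda_Roumieu_def using zero_less_one by blast
    show "jets_Roumieu \<M> \<inter> Lambda_Roumieu \<N> \<subset> (Lambda_Roumieu \<N> :: (('n \<Rightarrow> nat) \<Rightarrow> real) set)"
      "jets_Beurling \<M> \<inter> Lambda_Roumieu \<N> \<subset> (Lambda_Roumieu \<N> :: (('n \<Rightarrow> nat) \<Rightarrow> real) set)"
      "\<not> (Lambda_Roumieu \<N> :: (('n \<Rightarrow> nat) \<Rightarrow> real) set) \<subseteq> jets_Roumieu \<N>"
      using notin mem jets_Beurling_subset_Roumieu by blast+
  next
    assume lim: "\<forall>l>0. filterlim (\<lambda>k. root k (\<N> l k / fact k)) at_top sequentially"
    obtain \<beta> where pos: "\<And>k. 0 < \<beta> k"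
      and bound: "\<And>l h. 0 < l \<Longrightarrow> 0 < h \<Longrightarrow> \<exists>C. \<forall>k. \<beta> k / (h ^ k * (\<N> l k / fact k)) \<le> C"
      and "\<not> geometrically_bounded \<beta>"
      using exists_Beurling_witness[of "\<lambda>l k. \<N> l k / fact k"] posN monoN lim
      by (auto simp: divide_right_mono)
    define b where "b = (\<lambda>\<alpha>::'n \<Rightarrow> nat. \<beta> (mlen \<alpha>))"
    \<comment> \<open>Excluding Roumieu jets is the stronger statement:
      \<open>jets_Beurling_subset_Roumieu\<close> turns it into both Beurling claims below.\<close>
    have notin: "b \<notin> jets_Roumieu \<M>" "b \<notin> jets_Roumieu \<N>"
      using not_jets_Roumieu[OF assms(1,2) pos] not_jets_Roumieu[OF assms(3,4) pos]
        \<open>\<not> geometrically_bounded \<beta>\<close>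
      by (simp_all add: b_def)
    have "seqnorm_finite (\<N> l) h b" if "0 < l" "0 < h" for l h
      using bound[OF that] pos by (auto simp: seqnorm_finite_def b_def less_imp_le)
    then have mem: "b \<in> Lambda_Beurling \<N>"
      by (simp add: Lambda_Beurling_def)
    show "jets_Roumieu \<M> \<inter> Lambda_Beurling \<N> \<subset> (Lambda_Beurling \<N> :: (('n \<Rightarrow> nat) \<Rightarrow> real) set)"
      "jets_Beurling \<M> \<inter> Lambda_Beurling \<N> \<subset> (Lambda_Beurling \<N> :: (('n \<Rightarrow> nat) \<Rightarrow> real) set)"
      "\<not> (Lambda_Beurling \<N> :: (('n \<Rightarrow> nat) \<Rightarrow> real) set) \<subseteq> jets_Beurling \<N>"
      using notin mem jets_Beurling_subset_Roumieu by blast+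
  }
qed

end
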